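(* Let $P(\xi)=\sum_{|\alpha|\le m}c_\alpha\xi^\alpha$ be the symbol of an elliptic (constant-coefficient) differential operator of order $m\ge1$ on $\mathbb{R}^d$ with real coefficients $c_\alpha\in\mathbb{R}$, and fix $\delta>0$. Define, for $\lambda\in\mathbb{C}$, $$\mathcal{N}_\lambda:=\#\left\{\xi\in\mathbb{Z}^d:\ |P(\xi)-\lambda|\le|\xi|^{m-1+\delta}\right\}.$$ Then, as $|\lambda|\to\infty$, $$\mathcal{N}_\lambda\lesssim|\lambda|^{\frac{d-1+\delta}{m}},$$ where the implicit constant depends on $P$, $d$ and $\delta$.
   Context: For a multi-index $\alpha\in\mathbb{N}^d$, $|\alpha|=\alpha_1+\dots+\alpha_d$ and $\xi^\alpha=\xi_1^{\alpha_1}\cdots\xi_d^{\alpha_d}$. Ellipticity means $\sum_{|\alpha|=m}c_\alpha\xi^\alpha\ne0$ for all $\xi\in\mathbb{R}^d\setminus\{0\}$. $|\xi|$ is the Euclidean norm. $A\lesssim B$ means $A\le CB$ for a constant $C$.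
   Formalization: The formal theorem assumes 0<δ<1 instead of δ>0: for δ>1 the counted set is always infinite, and for δ=1 it is infinite e.g. for P(ξ)=ξ², d=1, λ>0; finiteness of the counted set is also proved. *)

theory Defs
  imports "HOL-Analysis.Analysis" "HOL-Library.Landau_Symbols"
begin

definition mi_order :: "nat ^ 'd \<Rightarrow> nat" where
  "mi_order \<alpha> = (\<Sum>i\<in>UNIV. \<alpha> $ i)"

definition mi_power :: "real ^ 'd \<Rightarrow> nat ^ 'd \<Rightarrow> real" where
  "mi_power \<xi> \<alpha> = (\<Prod>i\<in>UNIV. \<xi> $ i ^ (\<alpha> $ i))"

text \<open>The sums below range over finite sets, so none of them is the conventional value 0 of
  a sum over an infinite set.\<close>

lemma finite_mi_order_le: "finite {\<alpha> :: nat ^ 'd. mi_order \<alpha> \<le> m}"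
proof -
  have "{\<alpha> :: nat ^ 'd. mi_order \<alpha> \<le> m} \<subseteq> vec_lambda ` (UNIV \<rightarrow>\<^sub>E {..m})"
  proof
    fix \<alpha> :: "nat ^ 'd"
    assume "\<alpha> \<in> {\<alpha>. mi_order \<alpha> \<le> m}"
    then have le: "(\<Sum>i\<in>UNIV. \<alpha> $ i) \<le> m"
      by (simp add: mi_order_def)
    have "\<alpha> $ i \<le> m" for i
      using member_le_sum[of i UNIV "\<lambda>i. \<alpha> $ i"] le by simp
    then have "vec_nth \<alpha> \<in> UNIV \<rightarrow>\<^sub>E {..m}"
      by (auto simp: PiE_def extensional_def)
    then show "\<alpha> \<in> vec_lambda ` (UNIV \<rightarrow>\<^sub>E {..m})"
      by (metis image_eqI vec_nth_inverse)
  qed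
  then show ?thesis
    by (rule finite_subset) (intro finite_imageI finite_PiE; simp)
qed

lemma finite_mi_order_eq: "finite {\<alpha> :: nat ^ 'd. mi_order \<alpha> = m}"
  by (rule finite_subset[OF _ finite_mi_order_le[of m]]) auto

definition symbol :: "nat \<Rightarrow> (nat ^ 'd \<Rightarrow> real) \<Rightarrow> real ^ 'd \<Rightarrow> real" where
  "symbol m c \<xi> = (\<Sum>\<alpha> | mi_order \<alpha> \<le> m. c \<alpha> * mi_power \<xi> \<alpha>)"

definition elliptic :: "nat \<Rightarrow> (nat ^ 'd \<Rightarrow> real) \<Rightarrow> bool" where
  "elliptic m c \<longleftrightarrow> (\<forall>\<xi>. \<xi> \<noteq> 0 \<longrightarrow> (\<Sum>\<alpha> | mi_order \<alpha> = m. c \<alpha> * mi_power \<xi> \<alpha>) \<noteq> 0)"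

text \<open>The set of integer vectors whose cardinality is the counting function. The exponent is the
  real number \<open>m - 1 + \<delta>\<close>; for \<open>m \<ge> 1\<close> and \<open>\<delta> > 0\<close> it is positive, so at the origin the
  convention \<open>0 powr a = 0\<close> agrees with the usual power of 0.\<close>

definition near_lattice_points ::
    "nat \<Rightarrow> (nat ^ 'd \<Rightarrow> real) \<Rightarrow> real \<Rightarrow> complex \<Rightarrow> (real ^ 'd) set" where
  "near_lattice_points m c \<delta> z =
     {\<xi>. (\<forall>i. \<xi> $ i \<in> \<int>) \<and>
         cmod (complex_of_real (symbol m c \<xi>) - z) \<le> norm \<xi> powr (real m - 1 + \<delta>)}"

end

theory Submission imports Defs begin

text \<open>
  Let \<open>q\<close> be the principal symbol, write \<open>R = |z|^(1/m)\<close>, and let \<open>N\<close> be the set to be counted.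
  Ellipticity gives \<open>|q(\<xi>)| \<ge> a |\<xi>|^m\<close>; since \<open>\<delta> < 1\<close>, the permitted error \<open>|\<xi>|^(m-1+\<delta>)\<close> is of lower
  order than \<open>q\<close>, so every point of \<open>N\<close> has norm \<open>O(1 + R)\<close> (\<open>near_lattice_points_bound\<close>). In particular
  \<open>N\<close> is finite. Now let \<open>R \<ge> 1\<close>. Then on \<open>N\<close> one has \<open>q(\<xi>) = z + O(R^(m-1+\<delta>))\<close>, because passing from the symbol to
  \<open>q\<close> costs only \<open>O(R^(m-1))\<close>.

  The geometric reason for the bound is that \<open>N\<close> lies close to the level set \<open>q = z\<close>, in a
  region that meets every ray from the origin in a segment of length \<open>O(R^\<delta>)\<close>. This is turned into a count by packing disjoint copies of \<open>N\<close>
  into a ball (\<open>card_lattice_near_level_le\<close>). Dilate \<open>N\<close> by the factors \<open>s\<^sub>k = (1 + k h)^(1/m)\<close> with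
  \<open>0 \<le> k \<le> 1/h\<close>, where \<open>h\<close> is a large multiple of \<open>R^(\<delta>-1)\<close>. By homogeneity \<open>q\<close> is close to
  \<open>(1 + k h) z\<close> on the \<open>k\<close>-th copy, and the gap \<open>h |z|\<close>, a large multiple of \<open>R^(m-1+\<delta>)\<close>, exceeds
  both the errors and the oscillation \<open>O(R^(m-1))\<close> of \<open>q\<close> over a unit cube. Hence points in different
  copies are at sup-distance at least 1. Points in the same copy are so too, since lattice points
  are and the factors are at least 1. A ball of radius \<open>O(R)\<close> contains \<open>O(R^d)\<close> such points
  (\<open>card_sup_separated_le\<close>), while the copies together have at least \<open>card N / h\<close> points; so
  \<open>card N = O(h R^d) = O(R^(d-1+\<delta>))\<close>.
\<close>

section \<open>Packing separated dilates of a set of lattice points\<close>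

text \<open>Taking the floor of each coordinate puts every unit cell of the integer grid in charge of at
  most one point, and the ball meets at most \<open>2\<lceil>r\<rceil> + 1 \<le> 5 r\<close> cells per coordinate.\<close>
lemma card_sup_separated_le:
  fixes f :: "'a \<Rightarrow> real ^ 'd"
  assumes r: "r \<ge> 1"
    and bound: "\<And>a. a \<in> S \<Longrightarrow> norm (f a) \<le> r"
    and sep: "\<And>a b. a \<in> S \<Longrightarrow> b \<in> S \<Longrightarrow> (\<And>i. \<bar>f a $ i - f b $ i\<bar> < 1) \<Longrightarrow> a = b"
  shows "finite S" and "real (card S) \<le> (5 * r) ^ CARD('d)"
proof -
  define N where "N = \<lceil>r\<rceil>"
  define cell where "cell a = (\<lambda>i. \<lfloor>f a $ i\<rfloor>)" for a
  define B where "B = (UNIV :: 'd set) \<rightarrow>\<^sub>E {-N..N}"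
  have "inj_on cell S"
  proof (rule inj_onI)
    fix a b assume ab: "a \<in> S" "b \<in> S" "cell a = cell b"
    have "\<bar>f a $ i - f b $ i\<bar> < 1" for i
    proof -
      have "\<lfloor>f a $ i\<rfloor> = \<lfloor>f b $ i\<rfloor>"
        using fun_cong[OF ab(3), of i] by (simp add: cell_def)
      then show ?thesis by linarith
    qed
    then show "a = b" using sep ab by blast
  qed
  moreover have "cell ` S \<subseteq> B"
  proof -
    have "\<lfloor>f a $ i\<rfloor> \<in> {-N..N}" if "a \<in> S" for a i
    proof -
      have "\<bar>f a $ i\<bar> \<le> r"
        using component_le_norm_cart[of "f a" i] bound[OF that] by linarith
      then show ?thesis unfolding N_def by (simp add: le_floor_iff floor_le_iff) linarith
    qed
    then show ?thesis by (auto simp: B_def cell_def)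
  qed
  moreover have "finite B" unfolding B_def by (intro finite_PiE) auto
  ultimately show "finite S" by (meson finite_imageD finite_subset)
  have "card S \<le> card B"
    using \<open>inj_on cell S\<close> \<open>cell ` S \<subseteq> B\<close> \<open>finite B\<close> by (rule card_inj_on_le)
  also have "card B = nat (2 * N + 1) ^ CARD('d)"
    unfolding B_def by (simp add: card_PiE)
  finally have "real (card S) \<le> real (nat (2 * N + 1)) ^ CARD('d)"
    by (metis of_nat_le_iff of_nat_power)
  also have "\<dots> \<le> (5 * r) ^ CARD('d)"
    using r unfolding N_def by (intro power_mono) linarith+
  finally show "real (card S) \<le> (5 * r) ^ CARD('d)" .
qed

lemma lattice_eqI:
  fixes x y :: "real ^ 'd"
  assumes "\<And>i. x $ i \<in> \<int>" "\<And>i. y $ i \<in> \<int>" "\<And>i. \<bar>x $ i - y $ i\<bar> < 1"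
  shows "x = y"
  unfolding vec_eq_iff using assms by (metis Ints_eq_abs_less1)

text \<open>The dilates of \<open>A\<close> by the \<open>m\<close>-th roots of \<open>1 + k h\<close>, for \<open>0 \<le> k \<le> 1/h\<close>, stay in the ball of
  radius \<open>2 r\<close>, and on the \<open>k\<close>-th one \<open>q\<close> is within \<open>2 E\<close> of \<open>(1 + k h) z\<close>. The hypothesis on \<open>gap\<close> says
  that two such levels differ by more than the two errors and the oscillation \<open>\<omega>\<close> of \<open>q\<close> over a unit
  cube, so different dilates are separated and more than \<open>1/h\<close> copies of \<open>A\<close> fit into the
  ball. For \<open>h > 1\<close> only the copy \<open>k = 0\<close> remains, and the estimate is still correct.\<close>
lemma card_lattice_near_level_le:
  fixes q :: "real ^ 'd \<Rightarrow> real"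
  assumes m: "m \<ge> 1"
    and hom: "\<And>s x. q (s *\<^sub>R x) = s ^ m * q x"
    and r: "r \<ge> 1" and h: "h > 0"
    and lattice: "\<And>x i. x \<in> A \<Longrightarrow> x $ i \<in> \<int>"
    and bound: "\<And>x. x \<in> A \<Longrightarrow> norm x \<le> r"
    and level: "\<And>x. x \<in> A \<Longrightarrow> cmod (of_real (q x) - z) \<le> E"
    and osc: "\<And>x y. norm x \<le> 2 * r \<Longrightarrow> norm y \<le> 2 * r \<Longrightarrow>
                (\<And>i. \<bar>x $ i - y $ i\<bar> < 1) \<Longrightarrow> \<bar>q x - q y\<bar> \<le> \<omega>"
    and gap: "4 * E + \<omega> < h * cmod z"
  shows "real (card A) \<le> h * (10 * r) ^ CARD('d)"
proof -
  define K where "K = nat \<lfloor>1 / h\<rfloor>"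
  define t where "t k = 1 + real k * h" for k :: nat
  define s where "s k = root m (t k)" for k
  have t: "1 \<le> t k" "t k \<le> 2" if "k \<le> K" for k
  proof -
    have "real k \<le> 1 / h" using that h unfolding K_def by (simp add: le_nat_floor nat_floor_neg le_nat_iff le_floor_iff)
    then show "1 \<le> t k" "t k \<le> 2" using h by (simp_all add: t_def field_simps)
  qed
  have s_pow: "s k ^ m = t k" if "k \<le> K" for k
    unfolding s_def using m t[OF that] by (simp add: real_root_pow_pos2)
  have s: "1 \<le> s k" "s k \<le> 2" if "k \<le> K" for k
  proof -
    show s1: "1 \<le> s k" unfolding s_def using m t[OF that] by simp
    have "s k \<le> s k ^ m" using m s1 by (simp add: self_le_power)
    then show "s k \<le> 2" using s_pow[OF that] t[OF that] by simp
  qed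
  have norm_le: "norm (s k *\<^sub>R x) \<le> 2 * r" if "k \<le> K" "x \<in> A" for k x
    using s[OF that(1)] bound[OF that(2)] r by (auto intro!: mult_mono)
  have separated_levels: False
    if jk: "j < k" "k \<le> K" and xy: "x \<in> A" "y \<in> A"
      and close: "\<And>i. \<bar>(s j *\<^sub>R x) $ i - (s k *\<^sub>R y) $ i\<bar> < 1" for j k x y
  proof -
    have j: "j \<le> K" using jk by simp
    have "\<bar>t j * q x - t k * q y\<bar> \<le> \<omega>"
      using osc[OF norm_le[OF j xy(1)] norm_le[OF jk(2) xy(2)] close] by (simp add: hom s_pow j jk)
    then have 1: "cmod (of_real (t j) * of_real (q x) - of_real (t k) * of_real (q y)) \<le> \<omega>"
      by (metis norm_of_real of_real_diff of_real_mult)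
    have dil: "cmod (of_real (t i) * of_real (q w) - of_real (t i) * z) \<le> 2 * E"
      if "i \<le> K" "w \<in> A" for i w
    proof -
      have "cmod (of_real (t i) * of_real (q w) - of_real (t i) * z)
            = t i * cmod (of_real (q w) - z)"
        using t[OF that(1)] by (simp flip: right_diff_distrib add: norm_mult)
      also have "\<dots> \<le> 2 * E" using t[OF that(1)] level[OF that(2)] by (intro mult_mono) auto
      finally show ?thesis .
    qed
    have "cmod (of_real (t k) * z - of_real (t j) * z) = (t k - t j) * cmod z"
    proof -
      have "t j \<le> t k" using jk h by (simp add: t_def)
      then show ?thesis by (simp flip: left_diff_distrib of_real_diff add: norm_mult)
    qed
    moreover have "h \<le> t k - t j"
    proof -
      have "1 * h \<le> (real k - real j) * h" using jk h by (intro mult_right_mono) auto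
      then show ?thesis by (simp add: t_def algebra_simps)
    qed
    ultimately have 2: "h * cmod z \<le> cmod (of_real (t k) * z - of_real (t j) * z)"
      by (simp add: mult_right_mono)
    have tri: "cmod (a - b) \<le> cmod (u - v) + cmod (u - b) + cmod (v - a)" for a b u v
    proof -
      have "a - b = (u - b) - (u - v) - (v - a)" by simp
      then show ?thesis by (metis add.commute norm_triangle_ineq4 norm_triangle_le_diff order_trans add_right_mono)
    qed
    show False using 1 2 tri dil[OF j xy(1)] dil[OF jk(2) xy(2)] gap by (smt (verit))
  qed
  have sep: "p = p'" if p: "p \<in> {..K} \<times> A" "p' \<in> {..K} \<times> A"
      and close: "\<And>i. \<bar>(case p of (k, x) \<Rightarrow> s k *\<^sub>R x) $ i - (case p' of (k, x) \<Rightarrow> s k *\<^sub>R x) $ i\<bar> < 1"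
    for p p'
  proof -
    obtain j x where jx: "p = (j, x)" "j \<le> K" "x \<in> A" using p by auto
    obtain k y where ky: "p' = (k, y)" "k \<le> K" "y \<in> A" using p by auto
    have close': "\<bar>(s j *\<^sub>R x) $ i - (s k *\<^sub>R y) $ i\<bar> < 1" for i using close[of i] jx ky by simp
    have "j = k"
    proof (rule linorder_cases[of j k])
      assume "j < k" then show ?thesis using separated_levels[OF _ ky(2) jx(3) ky(3) close'] by simp
    next
      assume "k < j" then show ?thesis
        using separated_levels[OF _ jx(2) ky(3) jx(3)] close'[unfolded abs_minus_commute[of "(s j *\<^sub>R x) $ _"]]
        by blast
    qed
    moreover have "x = y"
    proof (rule lattice_eqI)
      fix i
      have "\<bar>x $ i - y $ i\<bar> \<le> s j * \<bar>x $ i - y $ i\<bar>"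
        using s[OF jx(2)] mult_right_mono[of 1 "s j" "\<bar>x $ i - y $ i\<bar>"] by simp
      also have "\<dots> = \<bar>s j * x $ i - s j * y $ i\<bar>"
        using s[OF jx(2)] by (simp flip: right_diff_distrib add: abs_mult)
      also have "\<dots> < 1" using close'[of i] \<open>j = k\<close> by simp
      finally show "\<bar>x $ i - y $ i\<bar> < 1" .
    qed (use lattice jx ky in auto)
    ultimately show ?thesis using jx ky by simp
  qed
  have "real (card ({..K} \<times> A)) \<le> (5 * (2 * r)) ^ CARD('d)"
    by (rule card_sup_separated_le(2)[where f = "\<lambda>(k, x). s k *\<^sub>R x"])
       (use r norm_le sep in auto)
  then have "(real K + 1) * real (card A) \<le> (10 * r) ^ CARD('d)"
    by (simp add: card_cartesian_product algebra_simps)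
  moreover have "1 / h \<le> real K + 1" unfolding K_def using h by linarith
  ultimately have "1 / h * real (card A) \<le> (10 * r) ^ CARD('d)"
    by (meson mult_right_mono of_nat_0_le_iff order_trans)
  then show ?thesis using h by (simp add: field_simps)
qed

section \<open>Monomials and the principal symbol\<close>

lemma mi_power_scaleR: "mi_power (s *\<^sub>R \<xi>) \<alpha> = s ^ mi_order \<alpha> * mi_power \<xi> \<alpha>"
  by (simp add: mi_power_def mi_order_def power_mult_distrib prod.distrib power_sum)

lemma abs_mi_power_le: "\<bar>mi_power \<xi> \<alpha>\<bar> \<le> norm \<xi> ^ mi_order \<alpha>"
proof -
  have "\<bar>mi_power \<xi> \<alpha>\<bar> = (\<Prod>i\<in>UNIV. \<bar>\<xi> $ i\<bar> ^ (\<alpha> $ i))"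
    by (simp add: mi_power_def abs_prod power_abs)
  also have "\<dots> \<le> (\<Prod>i\<in>UNIV. norm \<xi> ^ (\<alpha> $ i))"
    by (intro prod_mono conjI power_mono component_le_norm_cart) auto
  finally show ?thesis by (simp add: mi_order_def power_sum)
qed

lemma mi_power_lipschitz:
  assumes "norm x \<le> 1" "norm y \<le> 1" "\<And>i. \<bar>x $ i - y $ i\<bar> \<le> \<epsilon>"
  shows "\<bar>mi_power x \<alpha> - mi_power y \<alpha>\<bar> \<le> real (mi_order \<alpha>) * \<epsilon>"
proof -
  have 1: "\<bar>x $ i\<bar> \<le> 1" "\<bar>y $ i\<bar> \<le> 1" for i
    using component_le_norm_cart[of x i] component_le_norm_cart[of y i] assms by linarith+
  have "\<bar>mi_power x \<alpha> - mi_power y \<alpha>\<bar> \<le> (\<Sum>i\<in>UNIV. \<bar>x $ i ^ (\<alpha> $ i) - y $ i ^ (\<alpha> $ i)\<bar>)"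
    unfolding mi_power_def
    using norm_prod_diff[of UNIV "\<lambda>i. x $ i ^ (\<alpha> $ i)" "\<lambda>i. y $ i ^ (\<alpha> $ i)"] 1
    by (simp add: power_abs power_le_one)
  also have "\<dots> \<le> (\<Sum>i\<in>UNIV. real (\<alpha> $ i) * \<epsilon>)"
  proof (rule sum_mono)
    fix i
    have "\<bar>x $ i ^ (\<alpha> $ i) - y $ i ^ (\<alpha> $ i)\<bar> \<le> real (\<alpha> $ i) * \<bar>x $ i - y $ i\<bar>"
      using norm_power_diff[of "x $ i" "y $ i" "\<alpha> $ i"] 1 by simp
    also have "\<dots> \<le> real (\<alpha> $ i) * \<epsilon>" using assms(3) by (intro mult_left_mono) auto
    finally show "\<bar>x $ i ^ (\<alpha> $ i) - y $ i ^ (\<alpha> $ i)\<bar> \<le> real (\<alpha> $ i) * \<epsilon>" .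
  qed
  finally show ?thesis by (simp add: mi_order_def sum_distrib_right)
qed

definition principal_symbol :: "nat \<Rightarrow> (nat ^ 'd \<Rightarrow> real) \<Rightarrow> real ^ 'd \<Rightarrow> real" where
  "principal_symbol m c \<xi> = (\<Sum>\<alpha> | mi_order \<alpha> = m. c \<alpha> * mi_power \<xi> \<alpha>)"

text \<open>A single size for the coefficients, used as the constant both for the lower-order terms and
  for the oscillation of the principal part.\<close>
definition coeff_sum :: "nat \<Rightarrow> (nat ^ 'd \<Rightarrow> real) \<Rightarrow> real" where
  "coeff_sum m c = (\<Sum>\<alpha> | mi_order \<alpha> \<le> m. \<bar>c \<alpha>\<bar>)"

lemma coeff_sum_nonneg: "0 \<le> coeff_sum m c"
  by (simp add: coeff_sum_def sum_nonneg)

lemma principal_symbol_scaleR: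
  "principal_symbol m c (s *\<^sub>R \<xi>) = s ^ m * principal_symbol m c \<xi>"
  by (simp add: principal_symbol_def mi_power_scaleR sum_distrib_left mult_ac)

lemma abs_sum_coeff_le:
  fixes c :: "nat ^ 'd \<Rightarrow> real"
  assumes "I \<subseteq> {\<alpha>. mi_order \<alpha> \<le> m}" "\<And>\<alpha>. \<alpha> \<in> I \<Longrightarrow> \<bar>g \<alpha>\<bar> \<le> b" "b \<ge> 0"
  shows "\<bar>\<Sum>\<alpha>\<in>I. c \<alpha> * g \<alpha>\<bar> \<le> coeff_sum m c * b"
proof -
  have "\<bar>\<Sum>\<alpha>\<in>I. c \<alpha> * g \<alpha>\<bar> \<le> (\<Sum>\<alpha>\<in>I. \<bar>c \<alpha>\<bar> * \<bar>g \<alpha>\<bar>)"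
    using sum_abs[of "\<lambda>\<alpha>. c \<alpha> * g \<alpha>" I] by (simp add: abs_mult)
  also have "\<dots> \<le> (\<Sum>\<alpha>\<in>I. \<bar>c \<alpha>\<bar> * b)"
    using assms(2) by (intro sum_mono mult_left_mono) auto
  also have "\<dots> \<le> (\<Sum>\<alpha> | mi_order \<alpha> \<le> m. \<bar>c \<alpha>\<bar> * b)"
    using assms by (intro sum_mono2 finite_mi_order_le) auto
  finally show ?thesis by (simp add: coeff_sum_def sum_distrib_right)
qed

text \<open>Only monomials of order at most \<open>m - 1\<close> survive. The bound is in terms of a radius
  \<open>r \<ge> 1\<close> rather than \<open>norm \<xi>\<close>, so that it also covers points near the origin, where lower powers of
  \<open>norm \<xi>\<close> dominate higher ones.\<close>
lemma symbol_minus_principal_symbol_le: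
  assumes "m \<ge> 1" "r \<ge> 1" "norm \<xi> \<le> r"
  shows "\<bar>symbol m c \<xi> - principal_symbol m c \<xi>\<bar> \<le> coeff_sum m c * r ^ (m - 1)"
proof -
  have "symbol m c \<xi> = (\<Sum>\<alpha> | mi_order \<alpha> < m. c \<alpha> * mi_power \<xi> \<alpha>) + principal_symbol m c \<xi>"
  proof -
    have "{\<alpha> :: nat ^ 'a. mi_order \<alpha> \<le> m} = {\<alpha>. mi_order \<alpha> < m} \<union> {\<alpha>. mi_order \<alpha> = m}" by auto
    moreover have "finite {\<alpha> :: nat ^ 'a. mi_order \<alpha> < m}"
      by (rule finite_subset[OF _ finite_mi_order_le[of m]]) auto
    ultimately show ?thesis unfolding symbol_def principal_symbol_def
      using finite_mi_order_eq[of m] by (simp only:) (rule sum.union_disjoint; auto)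
  qed
  moreover have "\<bar>\<Sum>\<alpha> | mi_order \<alpha> < m. c \<alpha> * mi_power \<xi> \<alpha>\<bar> \<le> coeff_sum m c * r ^ (m - 1)"
  proof (rule abs_sum_coeff_le)
    fix \<alpha> :: "nat ^ 'a" assume "\<alpha> \<in> {\<alpha>. mi_order \<alpha> < m}"
    then have "\<bar>mi_power \<xi> \<alpha>\<bar> \<le> r ^ mi_order \<alpha>" and "mi_order \<alpha> \<le> m - 1"
      using abs_mi_power_le[of \<xi> \<alpha>] power_mono[OF assms(3), of "mi_order \<alpha>"] by auto
    then show "\<bar>mi_power \<xi> \<alpha>\<bar> \<le> r ^ (m - 1)"
      using power_increasing[of "mi_order \<alpha>" "m - 1" r] assms by linarith
  qed (use assms in auto)
  ultimately show ?thesis by simp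
qed

text \<open>By homogeneity it suffices to rescale to the unit ball, where monomials are Lipschitz; a distance
  1 becomes \<open>1/r\<close>, and this is the power of \<open>r\<close> by which the oscillation is smaller than
  \<open>r ^ m\<close>.\<close>
lemma principal_symbol_osc_le:
  assumes m: "m \<ge> 1" and r: "r \<ge> 1" and x: "norm x \<le> r" and y: "norm y \<le> r"
    and close: "\<And>i. \<bar>x $ i - y $ i\<bar> \<le> 1"
  shows "\<bar>principal_symbol m c x - principal_symbol m c y\<bar> \<le> coeff_sum m c * (real m * r ^ (m - 1))"
proof -
  have "principal_symbol m c x - principal_symbol m c y
        = (\<Sum>\<alpha> | mi_order \<alpha> = m. c \<alpha> * (mi_power x \<alpha> - mi_power y \<alpha>))"
    by (simp add: principal_symbol_def sum_subtractf right_diff_distrib)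
  also have "\<bar>\<dots>\<bar> \<le> coeff_sum m c * (real m * r ^ (m - 1))"
  proof (rule abs_sum_coeff_le)
    fix \<alpha> :: "nat ^ 'a" assume "\<alpha> \<in> {\<alpha>. mi_order \<alpha> = m}"
    then have \<alpha>: "mi_order \<alpha> = m" by simp
    let ?x = "(1 / r) *\<^sub>R x" and ?y = "(1 / r) *\<^sub>R y"
    have "\<bar>?x $ i - ?y $ i\<bar> \<le> 1 / r" for i
      using close[of i] r by (simp flip: diff_divide_distrib add: divide_right_mono)
    then have *: "\<bar>mi_power ?x \<alpha> - mi_power ?y \<alpha>\<bar> \<le> real m * (1 / r)"
      using mi_power_lipschitz[of ?x ?y "1 / r" \<alpha>] x y r \<alpha> by (simp add: field_simps)
    have "mi_power w \<alpha> = r ^ m * mi_power ((1 / r) *\<^sub>R w) \<alpha>" for w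
      using mi_power_scaleR[of r "(1 / r) *\<^sub>R w" \<alpha>] r \<alpha> by simp
    then have "\<bar>mi_power x \<alpha> - mi_power y \<alpha>\<bar> = r ^ m * \<bar>mi_power ?x \<alpha> - mi_power ?y \<alpha>\<bar>"
      using r by (metis abs_mult abs_of_nonneg order_trans right_diff_distrib zero_le_one zero_le_power)
    also have "\<dots> \<le> r ^ m * (real m * (1 / r))"
      using * r by (intro mult_left_mono) auto
    also have "\<dots> = real m * r ^ (m - 1)" using r m by (simp add: power_diff)
    finally show "\<bar>mi_power x \<alpha> - mi_power y \<alpha>\<bar> \<le> real m * r ^ (m - 1)" .
  qed (use r in auto)
  finally show ?thesis .
qed

text \<open>On the unit sphere this is compactness, and homogeneity extends it to the whole space.\<close>
lemma elliptic_lower_bound: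
  fixes c :: "nat ^ 'd \<Rightarrow> real"
  assumes "elliptic m c"
  obtains a where "a > 0" "\<And>\<xi>. a * norm \<xi> ^ m \<le> \<bar>principal_symbol m c \<xi>\<bar>"
proof -
  have "continuous_on (sphere 0 1) (\<lambda>\<xi> :: real ^ 'd. \<bar>principal_symbol m c \<xi>\<bar>)"
    unfolding principal_symbol_def mi_power_def by (intro continuous_intros)
  then obtain \<eta> :: "real ^ 'd" where \<eta>: "\<eta> \<in> sphere 0 1"
      "\<And>\<xi>. \<xi> \<in> sphere 0 1 \<Longrightarrow> \<bar>principal_symbol m c \<eta>\<bar> \<le> \<bar>principal_symbol m c \<xi>\<bar>"
    using continuous_attains_inf[of "sphere (0 :: real ^ 'd) 1" "\<lambda>\<xi>. \<bar>principal_symbol m c \<xi>\<bar>"] by auto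
  have pos: "\<bar>principal_symbol m c \<eta>\<bar> > 0"
  proof -
    have "\<eta> \<noteq> 0" using \<eta>(1) by auto
    then show ?thesis using assms by (simp add: elliptic_def principal_symbol_def)
  qed
  have "\<bar>principal_symbol m c \<eta>\<bar> * norm \<xi> ^ m \<le> \<bar>principal_symbol m c \<xi>\<bar>" for \<xi>
  proof (cases "\<xi> = 0")
    case True
    have "principal_symbol m c (0 *\<^sub>R \<eta>) = 0 ^ m * principal_symbol m c \<eta>"
      by (rule principal_symbol_scaleR)
    then show ?thesis using True by (cases "m = 0") (auto simp: abs_mult)
  next
    case False
    let ?u = "(1 / norm \<xi>) *\<^sub>R \<xi>"
    have "principal_symbol m c \<xi> = norm \<xi> ^ m * principal_symbol m c ?u"
      using principal_symbol_scaleR[of m c "norm \<xi>" ?u] False by simp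
    moreover have "\<bar>principal_symbol m c \<eta>\<bar> \<le> \<bar>principal_symbol m c ?u\<bar>"
      using False by (intro \<eta>(2)) simp
    ultimately show ?thesis by (simp add: abs_mult mult.commute mult_left_mono)
  qed
  then show thesis using pos that by blast
qed

section \<open>The counting function\<close>

text \<open>For \<open>norm \<xi> > C\<close> the lower-order terms and the permitted error together are at most half of the
  elliptic lower bound \<open>a * norm \<xi> ^ m\<close>, because \<open>m - 1 + \<delta> < m\<close>; the other half must then be bounded
  by \<open>cmod z\<close>.\<close>
lemma near_lattice_points_bound:
  fixes c :: "nat ^ 'd \<Rightarrow> real"
  assumes m: "m \<ge> 1" and ell: "elliptic m c" and \<delta>: "\<delta> > 0" "\<delta> < 1"
  obtains C where "C \<ge> 1"
    "\<And>z R \<xi>. R \<ge> 1 \<Longrightarrow> cmod z \<le> R ^ m \<Longrightarrow> \<xi> \<in> near_lattice_points m c \<delta> z \<Longrightarrow> norm \<xi> \<le> C * R"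
proof -
  obtain a where a: "a > 0" "\<And>\<xi>. a * norm \<xi> ^ m \<le> \<bar>principal_symbol m c \<xi>\<bar>"
    using elliptic_lower_bound[OF ell] by blast
  define B where "B = 1 + coeff_sum m c"
  have B: "B \<ge> 1" using coeff_sum_nonneg[of m c] by (simp add: B_def)
  (* The first threshold makes B * n powr (m - 1 + delta) at most a/2 * n ^ m for n > C, the second
     one absorbs the factor in n ^ m <= 2/a * R ^ m. *)
  define C where "C = max (max 1 ((2 * B / a) powr (1 / (1 - \<delta>)))) (2 / a)"
  have C: "C \<ge> 1" "(2 * B / a) powr (1 / (1 - \<delta>)) \<le> C" "2 / a \<le> C" by (auto simp: C_def)
  have "norm \<xi> \<le> C * R"
    if R: "R \<ge> 1" and z: "cmod z \<le> R ^ m" and \<xi>: "\<xi> \<in> near_lattice_points m c \<delta> z" for z R \<xi>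
  proof (cases "norm \<xi> \<le> C")
    case True
    have "C * 1 \<le> C * R" using R C by (intro mult_left_mono) auto
    then show ?thesis using True by simp
  next
    case False
    define n where "n = norm \<xi>"
    have n: "n > C" "n \<ge> 1" using False C by (auto simp: n_def)
    have n_pow: "n ^ (m - 1) = n powr (real m - 1)"
      using n m by (simp add: powr_realpow[symmetric] of_nat_diff)
    have "cmod (of_real (symbol m c \<xi>) - z) \<le> n powr (real m - 1 + \<delta>)"
      using \<xi> by (simp add: near_lattice_points_def n_def)
    moreover have "\<bar>symbol m c \<xi> - principal_symbol m c \<xi>\<bar> \<le> coeff_sum m c * n powr (real m - 1 + \<delta>)"
    proof -
      have "\<bar>symbol m c \<xi> - principal_symbol m c \<xi>\<bar> \<le> coeff_sum m c * n ^ (m - 1)"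
        by (rule symbol_minus_principal_symbol_le) (use m n in \<open>auto simp: n_def\<close>)
      also have "\<dots> \<le> coeff_sum m c * n powr (real m - 1 + \<delta>)"
        unfolding n_pow using n \<delta> coeff_sum_nonneg by (intro mult_left_mono powr_mono) auto
      finally show ?thesis .
    qed
    moreover have "\<bar>symbol m c \<xi>\<bar> \<le> cmod (of_real (symbol m c \<xi>) - z) + cmod z"
      using norm_triangle_sub[of "of_real (symbol m c \<xi>)" z] by simp
    ultimately have "a * n ^ m \<le> R ^ m + B * n powr (real m - 1 + \<delta>)"
      using a(2)[of \<xi>] z unfolding n_def B_def distrib_right by linarith
    also have "B * n powr (real m - 1 + \<delta>) \<le> a / 2 * n ^ m"
    proof -
      have "2 * B / a = ((2 * B / a) powr (1 / (1 - \<delta>))) powr (1 - \<delta>)"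
        using \<delta> a B by (simp add: powr_powr)
      also have "\<dots> \<le> n powr (1 - \<delta>)" using \<delta> n C by (intro powr_mono2) auto
      finally have "B \<le> a / 2 * n powr (1 - \<delta>)" using a by (simp add: field_simps)
      then have "B * n powr (real m - 1 + \<delta>) \<le> a / 2 * (n powr (1 - \<delta>) * n powr (real m - 1 + \<delta>))"
        by (metis mult.assoc mult_right_mono powr_ge_zero)
      also have "n powr (1 - \<delta>) * n powr (real m - 1 + \<delta>) = n ^ m"
        using n by (simp add: powr_realpow flip: powr_add)
      finally show ?thesis .
    qed
    finally have "n ^ m \<le> 2 / a * R ^ m" using a by (simp add: field_simps)
    also have "\<dots> \<le> C ^ m * R ^ m"
      using C self_le_power[of C m] m R by (intro mult_right_mono) auto
    finally have "n ^ m \<le> (C * R) ^ m" by (simp add: power_mult_distrib)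
    then show ?thesis unfolding n_def using C R m by (subst (asm) power_mono_iff) auto
  qed
  then show thesis using C(1) that by blast
qed

(* Since card of an infinite set is 0, finiteness is part of the conclusion. The bound delta < 1
   is needed for it: for delta > 1 the sets contain all but finitely many lattice points, and for
   delta = 1 they can be infinite, e.g. for P(xi) = xi^2 in dimension one and real z > 0. *)
theorem lemma6:
  fixes c :: "nat ^ 'd \<Rightarrow> real" and m :: nat and \<delta> :: real
  assumes "m \<ge> 1" and "elliptic m c" and "\<delta> > 0" and "\<delta> < 1"
  shows "(\<forall>z. finite (near_lattice_points m c \<delta> z)) \<and>
         (\<lambda>z. real (card (near_lattice_points m c \<delta> z)))
           \<in> O[at_infinity](\<lambda>z::complex. cmod z powr ((real CARD('d) - 1 + \<delta>) / real m))"
proof (intro conjI allI)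
  obtain C where C: "C \<ge> 1"
    "\<And>z R \<xi>. R \<ge> 1 \<Longrightarrow> cmod z \<le> R ^ m \<Longrightarrow> \<xi> \<in> near_lattice_points m c \<delta> z \<Longrightarrow> norm \<xi> \<le> C * R"
    using near_lattice_points_bound[OF assms] by blast
  have lattice: "\<xi> $ i \<in> \<int>" if "\<xi> \<in> near_lattice_points m c \<delta> z" for \<xi> i z
    using that by (simp add: near_lattice_points_def)
  show "finite (near_lattice_points m c \<delta> z)" for z
  proof (rule card_sup_separated_le(1)[where f = "\<lambda>x. x" and r = "C * (1 + cmod z)"])
    have "1 + cmod z \<le> (1 + cmod z) ^ m" using assms(1) by (intro self_le_power) auto
    then show "norm \<xi> \<le> C * (1 + cmod z)" if "\<xi> \<in> near_lattice_points m c \<delta> z" for \<xi>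
      using that by (intro C(2)[of _ z]) auto
    show "1 \<le> C * (1 + cmod z)" using C(1) mult_mono[of 1 C 1 "1 + cmod z"] by simp
  qed (use lattice lattice_eqI in blast)

  define \<beta> where "\<beta> = real m - 1 + \<delta>"
  define S where "S = coeff_sum m c"
  have S: "S \<ge> 0" by (simp add: S_def coeff_sum_nonneg)
  (* With h = D * R powr (delta - 1), the product h * cmod z is D * R powr beta. The first two
     summands of D account for the errors and the oscillation, and the last makes the
     inequality strict. *)
  define D where "D = 4 * ((1 + S) * C powr \<beta>) + S * (real m * (2 * C) ^ (m - 1)) + 1"
  have D: "D \<ge> 1" using S C(1) by (simp add: D_def)
  have main: "real (card (near_lattice_points m c \<delta> z))
      \<le> D * (10 * C) ^ CARD('d) * cmod z powr ((real CARD('d) - 1 + \<delta>) / real m)"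
    if z: "cmod z \<ge> 1" for z
  proof -
    define R where "R = root m (cmod z)"
    have R: "R \<ge> 1" "R ^ m = cmod z" using z assms(1) by (simp_all add: R_def real_root_pow_pos2)
    define r where "r = C * R"
    have r: "r \<ge> 1" using C(1) R(1) mult_mono[of 1 C 1 R] by (simp add: r_def)
    have pow_le: "x ^ (m - 1) \<le> x powr \<beta>" if "x \<ge> 1" for x
    proof -
      have "x ^ (m - 1) = x powr real (m - 1)" using that by (simp add: powr_realpow)
      also have "\<dots> \<le> x powr \<beta>" using that assms by (intro powr_mono) (auto simp: \<beta>_def)
      finally show ?thesis .
    qed
    define E where "E = (1 + S) * r powr \<beta>"
    define \<omega> where "\<omega> = S * (real m * (2 * r) ^ (m - 1))"
    define h where "h = D * R powr (\<delta> - 1)"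
    have "real (card (near_lattice_points m c \<delta> z)) \<le> h * (10 * r) ^ CARD('d)"
    proof (rule card_lattice_near_level_le[where q = "principal_symbol m c" and z = z and E = E and \<omega> = \<omega>])
      show "m \<ge> 1" "r \<ge> 1" by fact+
      show "h > 0" using D R(1) by (simp add: h_def)
      show "principal_symbol m c (s *\<^sub>R x) = s ^ m * principal_symbol m c x" for s x
        by (rule principal_symbol_scaleR)
      fix x i assume x: "x \<in> near_lattice_points m c \<delta> z"
      show "x $ i \<in> \<int>" using lattice x .
      show norm_x: "norm x \<le> r" unfolding r_def using C(2)[of R z x] x R by simp
      have "cmod (of_real (symbol m c x) - z) \<le> norm x powr \<beta>"
        using x by (simp add: near_lattice_points_def \<beta>_def)
      also have "\<dots> \<le> r powr \<beta>"
        using norm_x assms by (intro powr_mono2) (auto simp: \<beta>_def)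
      finally have 1: "cmod (of_real (symbol m c x) - z) \<le> r powr \<beta>" .
      have "\<bar>symbol m c x - principal_symbol m c x\<bar> \<le> S * r ^ (m - 1)"
        unfolding S_def by (rule symbol_minus_principal_symbol_le) (use assms r norm_x in auto)
      also have "\<dots> \<le> S * r powr \<beta>" using S pow_le[OF r] by (rule mult_left_mono[rotated])
      finally have "cmod (of_real (principal_symbol m c x) - of_real (symbol m c x)) \<le> S * r powr \<beta>"
        by (metis abs_minus_commute norm_of_real of_real_diff)
      then show "cmod (of_real (principal_symbol m c x) - z) \<le> E"
        using 1 norm_triangle_le[of "of_real (principal_symbol m c x) - of_real (symbol m c x)"
            "of_real (symbol m c x) - z" E]
        by (simp add: E_def algebra_simps)
    next
      fix x y :: "real ^ 'd"
      assume "norm x \<le> 2 * r" "norm y \<le> 2 * r" "\<And>i. \<bar>x $ i - y $ i\<bar> < 1"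
      then show "\<bar>principal_symbol m c x - principal_symbol m c y\<bar> \<le> \<omega>"
        unfolding \<omega>_def S_def using assms(1) r
        by (intro principal_symbol_osc_le) (auto intro: less_imp_le)
    next
      have "E = (1 + S) * C powr \<beta> * R powr \<beta>"
        using C(1) R(1) by (simp add: E_def r_def powr_mult)
      moreover have "\<omega> \<le> S * (real m * (2 * C) ^ (m - 1)) * R powr \<beta>"
      proof -
        have "\<omega> = S * (real m * (2 * C) ^ (m - 1)) * R ^ (m - 1)"
          by (simp add: \<omega>_def r_def power_mult_distrib)
        also have "\<dots> \<le> S * (real m * (2 * C) ^ (m - 1)) * R powr \<beta>"
          using S C(1) pow_le[OF R(1)] by (intro mult_left_mono) auto
        finally show ?thesis .
      qed
      ultimately have "4 * E + \<omega> \<le> (D - 1) * R powr \<beta>"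
        by (simp add: D_def algebra_simps)
      also have "\<dots> < D * R powr \<beta>" using R(1) by simp
      also have "\<dots> = h * cmod z"
      proof -
        have "R powr \<beta> = R powr (\<delta> - 1) * R powr real m"
          by (simp add: \<beta>_def flip: powr_add) (simp add: algebra_simps)
        then show ?thesis using R by (simp add: h_def powr_realpow)
      qed
      finally show "4 * E + \<omega> < h * cmod z" .
    qed
    also have "\<dots> = D * (10 * C) ^ CARD('d) * (R powr (\<delta> - 1) * R powr real CARD('d))"
      using R(1) by (simp add: h_def r_def power_mult_distrib powr_realpow)
    also have "R powr (\<delta> - 1) * R powr real CARD('d) = R powr (real CARD('d) - 1 + \<delta>)"
      by (simp flip: powr_add add: algebra_simps)
    also have "R = cmod z powr (1 / real m)"
      using z assms(1) by (simp add: R_def root_powr_inverse)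
    finally show ?thesis by (simp add: powr_powr)
  qed
  show "(\<lambda>z. real (card (near_lattice_points m c \<delta> z)))
           \<in> O[at_infinity](\<lambda>z::complex. cmod z powr ((real CARD('d) - 1 + \<delta>) / real m))"
  proof (rule bigoI)
    show "\<forall>\<^sub>F z in at_infinity. norm (real (card (near_lattice_points m c \<delta> z)))
            \<le> D * (10 * C) ^ CARD('d) * norm (cmod z powr ((real CARD('d) - 1 + \<delta>) / real m))"
      unfolding eventually_at_infinity
      using main by (intro exI[of _ 1]) (simp del: power_mult_distrib)
  qed
qed

end
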